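(* There exists a binary linear $[303,282,3]_2 3,2$ code (length $303$, codimension $21$, minimum distance $3$, covering radius $3$) with a parity-check matrix admitting a $(3,2)$-partition and also a $(3,1)$-partition into at most $35$ subsets. In particular $\ell_2(21,3)\le 303$.
   Context: For an $r\times n$ binary parity-check matrix $H$ and $0\le\ell\le R$, an $(R,\ell)$-partition is a partition of the columns of $H$ into nonempty subsets such that every vector of $\mathbb{F}_2^r$ (including zero) is the sum of at least $\ell$ and at most $R$ columns of $H$ lying in pairwise distinct subsets (zero counts as the empty sum when $\ell=0$). An $[n,n-r,d]_2R,\ell$ code is a binary linear code of length $n$, codimension $r$, minimum distance $d$, covering radius $R$ (smallest $R$ such that every vector of $\mathbb{F}_2^r$ is a sum of at most $R$ columns of a parity-check matrix), some parity-check matrix of which admits an $(R,\ell)$-partition. $\ell_2(r,R)$ is the smallest length of a binary linear code with codimension $r$ and covering radius $R$. *)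

theory Defs
  imports Main "HOL-Library.Disjoint_Sets"
begin

text \<open>A binary r x n matrix H is represented by H :: nat => nat => bool
  (H i j = True iff the entry in row i < r, column j < n is 1).
  Binary vectors of length m are represented by their supports, i.e.
  subsets of {..<m}; vector addition is symmetric difference.\<close>

definition colsum :: "(nat \<Rightarrow> nat \<Rightarrow> bool) \<Rightarrow> nat \<Rightarrow> nat set \<Rightarrow> nat set" where
  "colsum H r S = {i. i < r \<and> odd (card {j \<in> S. H i j})}"

definition code :: "(nat \<Rightarrow> nat \<Rightarrow> bool) \<Rightarrow> nat \<Rightarrow> nat \<Rightarrow> nat set set" where
  "code H r n = {S. S \<subseteq> {..<n} \<and> colsum H r S = {}}"

definition has_codimension :: "(nat \<Rightarrow> nat \<Rightarrow> bool) \<Rightarrow> nat \<Rightarrow> nat \<Rightarrow> bool" where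
  "has_codimension H r n \<longleftrightarrow> r \<le> n \<and> card (code H r n) = 2 ^ (n - r)"

definition has_min_distance :: "(nat \<Rightarrow> nat \<Rightarrow> bool) \<Rightarrow> nat \<Rightarrow> nat \<Rightarrow> nat \<Rightarrow> bool" where
  "has_min_distance H r n d \<longleftrightarrow>
     (\<exists>S \<in> code H r n. S \<noteq> {} \<and> card S = d) \<and>
     (\<forall>S \<in> code H r n. S \<noteq> {} \<longrightarrow> d \<le> card S)"

definition covers :: "(nat \<Rightarrow> nat \<Rightarrow> bool) \<Rightarrow> nat \<Rightarrow> nat \<Rightarrow> nat \<Rightarrow> bool" where
  "covers H r n R \<longleftrightarrow>
     (\<forall>v. v \<subseteq> {..<r} \<longrightarrow> (\<exists>S. S \<subseteq> {..<n} \<and> card S \<le> R \<and> colsum H r S = v))"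

definition has_covering_radius :: "(nat \<Rightarrow> nat \<Rightarrow> bool) \<Rightarrow> nat \<Rightarrow> nat \<Rightarrow> nat \<Rightarrow> bool" where
  "has_covering_radius H r n R \<longleftrightarrow> covers H r n R \<and> (\<forall>R' < R. \<not> covers H r n R')"

definition is_RL_partition ::
  "(nat \<Rightarrow> nat \<Rightarrow> bool) \<Rightarrow> nat \<Rightarrow> nat \<Rightarrow> nat \<Rightarrow> nat \<Rightarrow> nat set set \<Rightarrow> bool" where
  "is_RL_partition H r n R l P \<longleftrightarrow>
     partition_on {..<n} P \<and>
     (\<forall>v. v \<subseteq> {..<r} \<longrightarrow>
        (\<exists>S. S \<subseteq> {..<n} \<and> l \<le> card S \<and> card S \<le> R \<and> colsum H r S = v \<and>
             (\<forall>B \<in> P. card (S \<inter> B) \<le> 1)))"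

definition ell2 :: "nat \<Rightarrow> nat \<Rightarrow> nat" where
  "ell2 r R = (LEAST n. \<exists>H. has_codimension H r n \<and> has_covering_radius H r n R)"

end

theory Submission
  imports Defs "HOL-Library.Z2"
begin

text \<open>The code is a concatenation over \<open>F = GF(16)\<close>. Take 19 vectors \<open>h\<^sub>p\<close> of \<open>F\<^sub>2\<^sup>9\<close> with \<open>h\<^sub>0 = 0\<close> and
  attach to each a point \<open>P\<^sub>p\<close> of a hyperoval (18 points) of the projective plane over \<open>F\<close>, only two
  of the vectors sharing a point. The columns are the nonzero vectors \<open>(h\<^sub>p, x P\<^sub>p)\<close> with \<open>x \<in> F\<close>, so
  there are \<open>19 * 16 - 1 = 303\<close> of them in dimension \<open>9 + 3 * 4 = 21\<close>. If \<open>a = h\<^sub>p + h\<^sub>q + h\<^sub>r\<close> with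
  distinct points then \<open>P\<^sub>p, P\<^sub>q, P\<^sub>r\<close> form a basis of \<open>F\<^sup>3\<close>, hence every \<open>(a, b)\<close> is a sum of columns
  from the three blocks. The \<open>h\<^sub>p\<close> are chosen such that every other \<open>a\<close> is itself one of them, say
  \<open>a = h\<^sub>p\<close>. Then \<open>a = h\<^sub>p + h\<^sub>q + h\<^sub>q\<close> for every \<open>q\<close>, which reaches all \<open>b\<close> on the line through
  \<open>P\<^sub>p\<close> and \<open>P\<^sub>q\<close>; these lines cover the plane. For \<open>b = y P\<^sub>p\<close> this degenerates to a single column,
  which is also a sum of three columns of its own block. So the partition into singletons is a
  (3,2)-partition, and splitting the blocks over each point in two gives the (3,1)-partition.\<close>

section \<open>Parity-check matrices over the binary field\<close>

lemma odd_card_sym_diff: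
  assumes "finite A" "finite B"
  shows "odd (card (sym_diff A B)) \<longleftrightarrow> odd (card A) \<noteq> odd (card B)"
proof -
  have "card (sym_diff A B) = card (A - B) + card (B - A)"
    using assms by (intro card_Un_disjoint) auto
  moreover have "card A = card (A - B) + card (A \<inter> B)" "card B = card (B - A) + card (A \<inter> B)"
    using card_Int_Diff[OF assms(1), of B] card_Int_Diff[OF assms(2), of A]
    by (simp_all add: Int_commute)
  ultimately show ?thesis by auto
qed

lemma colsum_sym_diff:
  assumes "finite S" "finite T"
  shows "colsum H r (sym_diff S T) = sym_diff (colsum H r S) (colsum H r T)"
proof -
  have "{j \<in> sym_diff S T. H i j} = sym_diff {j \<in> S. H i j} {j \<in> T. H i j}" for i
    by auto
  then show ?thesis
    using assms by (auto simp: colsum_def odd_card_sym_diff)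
qed

lemma colsum_subset: "colsum H r S \<subseteq> {..<r}"
  by (auto simp: colsum_def)

text \<open>Covering makes the syndrome map onto. A fixed representative \<open>g v\<close> of each
  syndrome splits every vector uniquely into a syndrome and a codeword.\<close>

lemma has_codimension_if_covers:
  assumes "covers H r n R" "r \<le> n"
  shows "has_codimension H r n"
proof -
  obtain g where g: "\<And>v. v \<subseteq> {..<r} \<Longrightarrow> g v \<subseteq> {..<n} \<and> colsum H r (g v) = v"
    using assms(1) unfolding covers_def by metis
  have fin: "finite S" if "S \<subseteq> {..<n}" for S :: "nat set"
    using that finite_subset by blast
  have "bij_betw (\<lambda>(v, C). sym_diff C (g v)) (Pow {..<r} \<times> code H r n) (Pow {..<n})"
  proof (rule bij_betw_byWitness[where f' = "\<lambda>S. (colsum H r S, sym_diff S (g (colsum H r S)))"])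
    show "\<forall>x\<in>Pow {..<r} \<times> code H r n.
       (\<lambda>S. (colsum H r S, sym_diff S (g (colsum H r S)))) ((\<lambda>(v, C). sym_diff C (g v)) x) = x"
    proof
      fix x assume "x \<in> Pow {..<r} \<times> code H r n"
      then obtain v C where x: "x = (v, C)" and vC: "v \<subseteq> {..<r}" "C \<in> code H r n"
        by blast
      then have "colsum H r (sym_diff C (g v)) = v"
        using g[OF vC(1)] by (subst colsum_sym_diff) (auto simp: code_def intro: fin)
      moreover have "sym_diff (sym_diff C (g v)) (g v) = C" by blast
      ultimately show "(\<lambda>S. (colsum H r S, sym_diff S (g (colsum H r S))))
          ((\<lambda>(v, C). sym_diff C (g v)) x) = x"
        by (simp add: x)
    qed
    show "\<forall>S\<in>Pow {..<n}. (\<lambda>(v, C). sym_diff C (g v))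
        (colsum H r S, sym_diff S (g (colsum H r S))) = S"
      by auto
    show "(\<lambda>(v, C). sym_diff C (g v)) ` (Pow {..<r} \<times> code H r n) \<subseteq> Pow {..<n}"
      using g by (auto simp: code_def; blast)
    show "(\<lambda>S. (colsum H r S, sym_diff S (g (colsum H r S)))) ` Pow {..<n}
        \<subseteq> Pow {..<r} \<times> code H r n"
    proof (rule image_subsetI)
      fix S :: "nat set" assume "S \<in> Pow {..<n}"
      then have S: "S \<subseteq> {..<n}" by simp
      have gS: "g (colsum H r S) \<subseteq> {..<n}" "colsum H r (g (colsum H r S)) = colsum H r S"
        using g[OF colsum_subset] by auto
      then have "colsum H r (sym_diff S (g (colsum H r S))) = {}"
        using S by (subst colsum_sym_diff) (auto intro: fin)
      then show "(colsum H r S, sym_diff S (g (colsum H r S))) \<in> Pow {..<r} \<times> code H r n"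
        using S gS colsum_subset by (auto simp: code_def; blast)
    qed
  qed
  then have "card (Pow {..<r} \<times> code H r n) = card (Pow {..<n})"
    by (rule bij_betw_same_card)
  then have "2 ^ r * card (code H r n) = (2 ^ n :: nat)"
    by (simp add: card_cartesian_product card_Pow)
  also have "\<dots> = 2 ^ r * 2 ^ (n - r)"
    using assms(2) by (simp flip: power_add)
  finally show ?thesis
    using assms(2) by (simp add: has_codimension_def)
qed

text \<open>Counting: the pairs \<open>(a, b)\<close>, where \<open>a = b\<close> yields the single
  columns, and the empty set give at most n^2 + 1 sums.\<close>

lemma not_covers_2:
  assumes "Suc (n\<^sup>2) < 2 ^ r"
  shows "\<not> covers H r n 2"
proof
  assume cov: "covers H r n 2"
  let ?F = "insert {} ((\<lambda>(a, b). {a, b}) ` ({..<n} \<times> {..<n}))"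
  have "Pow {..<r} \<subseteq> colsum H r ` ?F"
  proof
    fix v assume "v \<in> Pow {..<r}"
    then obtain S where S: "S \<subseteq> {..<n}" "card S \<le> 2" "colsum H r S = v"
      using cov unfolding covers_def by blast
    then have "finite S" by (auto dest: finite_subset)
    consider "card S = 0" | "card S = 1" | "card S = 2" using S(2) by linarith
    then have "S = {} \<or> (\<exists>a b. S = {a, b})"
      using \<open>finite S\<close> by cases (auto simp: card_1_singleton_iff card_2_iff)
    with S(1) have "S \<in> ?F" by auto
    with S(3) show "v \<in> colsum H r ` ?F" by blast
  qed
  then have "card (Pow {..<r}) \<le> card ?F"
    by (intro surj_card_le) auto
  also have "\<dots> \<le> Suc (card ((\<lambda>(a, b). {a, b}) ` ({..<n} \<times> {..<n})))"
    by (rule card_insert_le_m1) auto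
  also have "\<dots> \<le> Suc (n\<^sup>2)"
    using card_image_le[of "{..<n} \<times> {..<n}" "\<lambda>(a, b). {a, b}"] by (simp add: power2_eq_square)
  finally show False using assms by (simp add: card_Pow)
qed

text \<open>With the fibres of a labelling \<open>f\<close> as blocks, lying in distinct blocks
  becomes injectivity of \<open>f\<close> on \<open>S\<close>.\<close>

lemma is_RL_partition_fibres:
  assumes "\<And>v. v \<subseteq> {..<r} \<Longrightarrow>
    \<exists>S. S \<subseteq> {..<n} \<and> l \<le> card S \<and> card S \<le> R \<and> colsum H r S = v \<and> inj_on f S"
  shows "is_RL_partition H r n R l ((\<lambda>c. {j. j < n \<and> f j = c}) ` f ` {..<n})"
  unfolding is_RL_partition_def
proof (intro conjI allI impI)
  show "partition_on {..<n} ((\<lambda>c. {j. j < n \<and> f j = c}) ` f ` {..<n})"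
    by (auto simp: partition_on_def disjoint_def)
next
  fix v assume "v \<subseteq> {..<r}"
  then obtain S where S: "S \<subseteq> {..<n}" "l \<le> card S" "card S \<le> R" "colsum H r S = v" "inj_on f S"
    using assms by blast
  have "card (S \<inter> {j. j < n \<and> f j = c}) \<le> 1" for c
    using S(5) by (intro card_le_Suc0_iff_eq[THEN iffD2, simplified One_nat_def[symmetric]])
      (auto dest: inj_onD)
  with S show "\<exists>S. S \<subseteq> {..<n} \<and> l \<le> card S \<and> card S \<le> R \<and> colsum H r S = v \<and>
      (\<forall>B\<in>(\<lambda>c. {j. j < n \<and> f j = c}) ` f ` {..<n}. card (S \<inter> B) \<le> 1)"
    by blast
qed

section \<open>The field with 16 elements\<close>

lemma all_bit: "(\<forall>x :: bit. P x) \<longleftrightarrow> P 0 \<and> P 1"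
  by (metis bit_not_zero_iff)

text \<open>\<open>GF a0 a1 a2 a3\<close> stands for \<open>a0 + a1 x + a2 x\<^sup>2 + a3 x\<^sup>3\<close> modulo \<open>x\<^sup>4 = x + 1\<close>.\<close>

datatype gf16 = GF bit bit bit bit

instantiation gf16 :: comm_ring_1
begin

definition "0 = GF 0 0 0 0"
definition "1 = GF 1 0 0 0"
fun plus_gf16 where
  "GF a0 a1 a2 a3 + GF b0 b1 b2 b3 = GF (a0 + b0) (a1 + b1) (a2 + b2) (a3 + b3)"
definition "- (a :: gf16) = a"
definition "(a :: gf16) - b = a + b"

text \<open>The coefficients of x^4, x^5 and x^6 are folded back along x + 1, x^2 + x and x^3 +
  x^2.\<close>

fun times_gf16 where
  "GF a0 a1 a2 a3 * GF b0 b1 b2 b3 =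
    GF (a0 * b0 + (a1 * b3 + a2 * b2 + a3 * b1))
       (a0 * b1 + a1 * b0 + (a1 * b3 + a2 * b2 + a3 * b1) + (a2 * b3 + a3 * b2))
       (a0 * b2 + a1 * b1 + a2 * b0 + (a2 * b3 + a3 * b2) + a3 * b3)
       (a0 * b3 + a1 * b2 + a2 * b1 + a3 * b0 + a3 * b3)"

instance
proof
  fix a b c :: gf16
  show "a * b * c = a * (b * c)"
    by (cases a; cases b; cases c)
      (simp only: plus_gf16.simps times_gf16.simps distrib_left distrib_right mult_ac add_ac)
  show "a * b = b * a"
    by (cases a; cases b)
      (simp only: plus_gf16.simps times_gf16.simps distrib_left distrib_right mult_ac add_ac)
  show "(a + b) * c = a * c + b * c"
    by (cases a; cases b; cases c)
      (simp only: plus_gf16.simps times_gf16.simps distrib_left distrib_right mult_ac add_ac)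
  show "a + b + c = a + (b + c)"
    by (cases a; cases b; cases c) (simp only: plus_gf16.simps add.assoc)
  show "a + b = b + a"
    by (cases a; cases b) (simp only: plus_gf16.simps add.commute)
  show "0 + a = a" "- a + a = 0"
    by (cases a; simp add: zero_gf16_def uminus_gf16_def)+
  show "1 * a = a"
    by (cases a) (simp add: one_gf16_def)
qed (simp_all add: zero_gf16_def one_gf16_def uminus_gf16_def minus_gf16_def)

end

lemma gf16_double [simp]: "(a :: gf16) + a = 0"
  by (cases a) (simp add: zero_gf16_def)

instantiation gf16 :: field
begin

text \<open>The inverse is \<open>a ^ 14 = a ^ 2 * a ^ 4 * a ^ 8\<close>.\<close>

definition "inverse (a :: gf16) = (let b = a * a; c = b * b; d = c * c in b * c * d)"
definition "a div (b :: gf16) = a * inverse b"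

instance
proof
  fix a :: gf16
  have "\<forall>a0 a1 a2 a3. GF a0 a1 a2 a3 \<noteq> 0 \<longrightarrow> inverse (GF a0 a1 a2 a3) * GF a0 a1 a2 a3 = 1"
    unfolding all_bit by (simp add: inverse_gf16_def one_gf16_def zero_gf16_def)
  then show "inverse a * a = 1" if "a \<noteq> 0"
    using that by (cases a) blast
  show "a div b = a * inverse b" for b
    by (rule divide_gf16_def)
  show "inverse (0 :: gf16) = 0"
    by (simp only: inverse_gf16_def Let_def mult_zero_left)
qed

end

section \<open>Coordinates and numbering of the field elements\<close>

primrec coord :: "gf16 \<Rightarrow> nat \<Rightarrow> bool" where
  "coord (GF a0 a1 a2 a3) n = ([a0, a1, a2, a3] ! n = 1)"

definition gf_of :: "(nat \<Rightarrow> bool) \<Rightarrow> gf16" where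
  "gf_of f = GF (of_bool (f 0)) (of_bool (f 1)) (of_bool (f 2)) (of_bool (f 3))"

lemma less_4E:
  assumes "(n :: nat) < 4"
  obtains "n = 0" | "n = 1" | "n = 2" | "n = 3"
  using assms by linarith

lemma bit_add_eq_1_iff: "x + y = 1 \<longleftrightarrow> (x = 1) \<noteq> (y = (1 :: bit))"
  by (cases x; cases y) simp_all

lemma coord_gf_of [simp]: "n < 4 \<Longrightarrow> coord (gf_of f) n = f n"
  by (erule less_4E) (simp_all add: gf_of_def)

lemma coord_add: "n < 4 \<Longrightarrow> coord (a + b) n \<longleftrightarrow> coord a n \<noteq> coord b n"
  by (erule less_4E; cases a; cases b) (simp_all add: bit_add_eq_1_iff)

lemma coord_zero [simp]: "n < 4 \<Longrightarrow> \<not> coord 0 n"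
  by (erule less_4E) (simp_all add: zero_gf16_def)

lemma gf16_eqI: "(\<And>n. n < 4 \<Longrightarrow> coord a n = coord b n) \<Longrightarrow> a = b"
proof (cases a; cases b)
  fix a0 a1 a2 a3 b0 b1 b2 b3
  assume *: "\<And>n. n < 4 \<Longrightarrow> coord a n = coord b n"
    and ab: "a = GF a0 a1 a2 a3" "b = GF b0 b1 b2 b3"
  show "a = b"
    using *[of 0] *[of 1] *[of 2] *[of 3] unfolding ab
    by simp (metis bit_not_one_iff)
qed

definition elt :: "nat \<Rightarrow> gf16" where
  "elt k = gf_of (bit k)"

lemma elt_0 [simp]: "elt 0 = 0"
  by (simp add: elt_def gf_of_def zero_gf16_def)

lemma elt_inj: "k < 16 \<Longrightarrow> l < 16 \<Longrightarrow> elt k = elt l \<Longrightarrow> k = l"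
proof -
  assume kl: "k < 16" "l < 16" "elt k = elt l"
  have "bit k n = bit l n" for n
  proof (cases "n < 4")
    case True
    then show ?thesis using kl(3) coord_gf_of unfolding elt_def by metis
  next
    case False
    then have "(2::nat) ^ 4 \<le> 2 ^ n" by (intro power_increasing) auto
    with kl show ?thesis by (simp add: bit_iff_odd)
  qed
  then show ?thesis by (simp add: bit_eq_iff)
qed

lemma elt_surj: "\<exists>k<16. elt k = a"
proof (cases a)
  case (GF a0 a1 a2 a3)
  let ?k = "of_bool (a0 = 1) + 2 * of_bool (a1 = 1) + 4 * of_bool (a2 = 1) + 8 * of_bool (a3 = 1) :: nat"
  have "?k < 16 \<and> elt ?k = a"
    unfolding GF
    by (cases a0; cases a1; cases a2; cases a3) (simp_all add: elt_def gf_of_def bit_iff_odd)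
  then show ?thesis by blast
qed

section \<open>A hyperoval over GF(16)\<close>

lemma all_less_3: "(\<forall>m<3. P m) \<longleftrightarrow> P 0 \<and> P 1 \<and> P (2 :: nat)"
  by (auto simp: less_Suc_eq numeral_3_eq_3 numeral_2_eq_2)

lemma vandermonde2:
  fixes s t :: "'a :: field"
  assumes "s \<noteq> t"
  shows "\<exists>x y. x + y = a \<and> x * s + y * t = b"
proof -
  define y where "y = (b - a * s) / (t - s)"
  have "(a - y) * s + y * t = a * s + y * (t - s)" by (simp add: algebra_simps)
  also have "y * (t - s) = b - a * s" using assms by (simp add: y_def)
  finally show ?thesis by (intro exI[of _ "a - y"] exI[of _ y]) simp
qed

lemma vandermonde3:
  fixes s t u :: "'a :: field"
  assumes "s \<noteq> t" "s \<noteq> u" "t \<noteq> u"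
  shows "\<exists>x y z. x + y + z = a \<and> x * s + y * t + z * u = b \<and> x * s\<^sup>2 + y * t\<^sup>2 + z * u\<^sup>2 = c"
proof -
  \<comment> \<open>Weighting the equations by the coefficients of (X - s)(X - t) eliminates
    \<open>x\<close> and \<open>y\<close>.\<close>
  define z where "z = (c - b * (s + t) + a * s * t) / ((u - s) * (u - t))"
  have z: "z * (u - s) * (u - t) = c - b * (s + t) + a * s * t"
    using assms by (simp add: z_def)
  obtain x y where xy: "x + y = a - z" "x * s + y * t = b - z * u"
    using vandermonde2[OF assms(1)] by blast
  have "x * s\<^sup>2 + y * t\<^sup>2 = (x * s + y * t) * (s + t) - (x + y) * s * t"
    by (simp add: algebra_simps power2_eq_square)
  also have "\<dots> + z * u\<^sup>2 = z * (u - s) * (u - t) + b * (s + t) - a * s * t"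
    unfolding xy by (simp add: algebra_simps power2_eq_square)
  finally have "x * s\<^sup>2 + y * t\<^sup>2 + z * u\<^sup>2 = c"
    by (simp add: z)
  moreover have "x + y + z = a" "x * s + y * t + z * u = b"
    using xy by simp_all
  ultimately show ?thesis by blast
qed

text \<open>In characteristic 2 both factors of a^2 - b^2 agree. Used for triples with the nucleus,
  where two conic points must match coordinates 0 and 2.\<close>

lemma square_eq_gf16: "(a :: gf16)\<^sup>2 = b\<^sup>2 \<Longrightarrow> a = b"
proof -
  assume "a\<^sup>2 = b\<^sup>2"
  then have "(a - b) * (a + b) = 0"
    by (simp add: algebra_simps power2_eq_square)
  then show "a = b" by (auto simp: minus_gf16_def eq_neg_iff_add_eq_0[symmetric] uminus_gf16_def)
qed

text \<open>The conic \<open>(1, s, s\<^sup>2)\<close> over \<open>GF(16)\<close>, completed by its point at infinity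
  and its nucleus to a hyperoval; \<open>m\<close> is the coordinate.\<close>

definition pnt :: "nat \<Rightarrow> nat \<Rightarrow> gf16" where
  "pnt t m = (if t < 16 then elt t ^ m else of_bool (t + m = 18))"

text \<open>No three hyperoval points are collinear. Conic points give a Vandermonde system; points
  16 and 17 are unit vectors and each absorbs one coordinate.\<close>

lemma pnt_independent:
  assumes "t1 < t2" "t2 < t3" "t3 < 18"
  shows "\<exists>x y z. \<forall>m<3. b m = x * pnt t1 m + y * pnt t2 m + z * pnt t3 m"
proof -
  have *: "?thesis" if "x * pnt t1 0 + y * pnt t2 0 + z * pnt t3 0 = b 0"
    "x * pnt t1 1 + y * pnt t2 1 + z * pnt t3 1 = b 1"
    "x * pnt t1 2 + y * pnt t2 2 + z * pnt t3 2 = b 2" for x y z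
    using that unfolding all_less_3 by metis
  have ne: "elt t1 \<noteq> elt t2" if "t2 < 16"
    using elt_inj[of t1 t2] assms that by auto
  consider "t3 < 16" | "t2 < 16" "t3 = 16" | "t2 < 16" "t3 = 17" | "t1 < 16" "t2 = 16" "t3 = 17"
    using assms by linarith
  then show ?thesis
  proof cases
    case 1
    then have "elt t1 \<noteq> elt t3" "elt t2 \<noteq> elt t3"
      using elt_inj[of t1 t3] elt_inj[of t2 t3] assms by auto
    with vandermonde3[of "elt t1" "elt t2" "elt t3" "b 0" "b 1" "b 2"] ne 1 assms
    obtain x y z where "x + y + z = b 0" "x * elt t1 + y * elt t2 + z * elt t3 = b 1"
      "x * (elt t1)\<^sup>2 + y * (elt t2)\<^sup>2 + z * (elt t3)\<^sup>2 = b 2"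
      by auto
    with 1 assms show ?thesis by (intro *[of x y z]) (simp_all add: pnt_def)
  next
    case 2
    obtain x y where "x + y = b 0" "x * elt t1 + y * elt t2 = b 1"
      using vandermonde2[OF ne[OF 2(1)]] by blast
    with 2 assms show ?thesis
      by (intro *[of x y "b 2 - (x * (elt t1)\<^sup>2 + y * (elt t2)\<^sup>2)"]) (simp_all add: pnt_def)
  next
    case 3
    obtain x y where "x + y = b 0" "x * (elt t1)\<^sup>2 + y * (elt t2)\<^sup>2 = b 2"
      using vandermonde2[of "(elt t1)\<^sup>2" "(elt t2)\<^sup>2"] ne[OF 3(1)] square_eq_gf16 by metis
    with 3 assms show ?thesis
      by (intro *[of x y "b 1 - (x * elt t1 + y * elt t2)"]) (simp_all add: pnt_def)
  next
    case 4
    then show ?thesis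
      by (intro *[of "b 0" "b 2 - b 0 * (elt t1)\<^sup>2" "b 1 - b 0 * elt t1"]) (simp_all add: pnt_def)
  qed
qed

text \<open>The lines through a fixed point of a hyperoval are exactly its secants through that point.\<close>

lemma pnt_secants_cover:
  assumes "p < 16"
  shows "\<exists>t y z. t < 18 \<and> t \<noteq> p \<and> (\<forall>m<3. b m = y * pnt p m + z * pnt t m)"
proof -
  have *: "?thesis" if "t < 18" "t \<noteq> p" "y * pnt p 0 + z * pnt t 0 = b 0"
    "y * pnt p 1 + z * pnt t 1 = b 1" "y * pnt p 2 + z * pnt t 2 = b 2" for t y z
    using that unfolding all_less_3 by metis
  define s where "s = elt p"
  \<comment> \<open>Subtracting \<open>b 0\<close> times the point \<open>p\<close> from
    \<open>b\<close> leaves (0, c1, c2). If an entry vanishes, this is a multiple of point 16 or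
    17.\<close>
  define c1 where "c1 = b 1 - b 0 * s"
  define c2 where "c2 = b 2 - b 0 * s\<^sup>2"
  have pnt_p: "pnt p 0 = 1" "pnt p (Suc 0) = s" "pnt p 2 = s\<^sup>2"
    using assms by (simp_all add: pnt_def s_def)
  show ?thesis
  proof (cases "c1 = 0 \<or> c2 = 0")
    case True
    then show ?thesis
    proof
      assume "c1 = 0"
      then show ?thesis
        using assms by (intro *[of 16 "b 0" c2]) (simp_all add: pnt_p, simp_all add: pnt_def c1_def c2_def s_def)
    next
      assume "c2 = 0"
      then show ?thesis
        using assms by (intro *[of 17 "b 0" c1]) (simp_all add: pnt_p, simp_all add: pnt_def c1_def c2_def s_def)
    qed
  next
    case False
    \<comment> \<open>Points \<open>t\<close> and \<open>p\<close> differ by (t - s)(0, 1, t + s),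
      with \<open>t\<close> read as its field element. Slope \<open>q\<close> thus forces t = q + s,
      and then t - s = q.\<close>
    define q where "q = c2 / c1"
    obtain t where t: "t < 16" "elt t = q + s" using elt_surj by blast
    have q: "q \<noteq> 0" "c1 * q = c2" using False by (simp_all add: q_def)
    have "t \<noteq> p" using t q by (auto simp: s_def)
    have ss: "s + s = 0" "s\<^sup>2 + s\<^sup>2 = 0" by (rule gf16_double)+
    define z where "z = c1 / q"
    have z: "z * q = c1" using q(1) by (simp add: z_def)
    show ?thesis
    proof (rule *[of t "b 0 - z" z])
      show "(b 0 - z) * pnt p 0 + z * pnt t 0 = b 0"
        using t by (simp add: pnt_p, simp add: pnt_def)
      have "(b 0 - z) * s + z * (q + s) = b 0 * s + z * q" by (simp add: algebra_simps)
      then show "(b 0 - z) * pnt p 1 + z * pnt t 1 = b 1"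
        using t z by (simp add: pnt_p, simp add: pnt_def c1_def)
      have "(b 0 - z) * s\<^sup>2 + z * (q + s)\<^sup>2 = b 0 * s\<^sup>2 + (z * q) * (q + (s + s))"
        by (simp only: algebra_simps power2_eq_square)
      also have "\<dots> = b 2" unfolding ss z using q by (simp add: c2_def)
      finally show "(b 0 - z) * pnt p 2 + z * pnt t 2 = b 2"
        using t by (simp add: pnt_p, simp add: pnt_def)
    qed (use t \<open>t \<noteq> p\<close> in auto)
  qed
qed

section \<open>The vectors of dimension nine\<close>

fun halves :: "bool \<Rightarrow> bool list list \<Rightarrow> bool list list" where
  "halves a [] = []"
| "halves True ((True # x) # L) = x # halves True L"
| "halves False ((False # x) # L) = x # halves False L"
| "halves a (_ # L) = halves a L"

text \<open>Decides by splitting on leading bits whether all words of length \<open>n\<close> occur,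
  without searching the list once per word.\<close>

primrec full :: "nat \<Rightarrow> bool list list \<Rightarrow> bool" where
  "full 0 L = (L \<noteq> [])"
| "full (Suc n) L = (full n (halves True L) \<and> full n (halves False L))"

lemma mem_halves_iff: "x \<in> set (halves a L) \<longleftrightarrow> a # x \<in> set L"
  by (induction a L rule: halves.induct) auto

lemma full_imp_mem:
  assumes "full n L" "\<forall>x\<in>set L. length x = n" "length v = n"
  shows "v \<in> set L"
  using assms
proof (induction n arbitrary: L v)
  case 0
  then show ?case by (cases L) auto
next
  case (Suc n)
  from Suc.prems(3) obtain a w where v: "v = a # w" "length w = n"
    by (cases v) auto
  have "full n (halves a L)" using Suc.prems(1) by (cases a) simp_all
  moreover have "\<forall>x\<in>set (halves a L). length x = n"
    using Suc.prems(2) by (force simp: mem_halves_iff)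
  ultimately have "w \<in> set (halves a L)" using Suc.IH v(2) by blast
  with v(1) show ?case by (simp add: mem_halves_iff)
qed

text \<open>Found by simulated annealing. The sums of three entries, at most one of them among the
  last two, are all vectors of \<open>F\<^sub>2\<^sup>9\<close> except the entries 1 to 5.\<close>

definition base :: "nat list" where
  "base = [0, 1, 2, 4, 8, 16, 32, 64, 128, 93, 256, 346, 460, 465, 218, 437, 443, 46, 411]"

definition bits9 :: "nat \<Rightarrow> bool list" where
  "bits9 x = map (bit x) [0..<9]"

text \<open>The bound 17 on \<open>q\<close> keeps entries 17 and 18, which share a point, out of a
  common triple.\<close>

definition triples :: "(nat \<times> nat \<times> nat) list" where
  "triples = [(p, q, r). r \<leftarrow> [0..<19], q \<leftarrow> [0..<min r 17], p \<leftarrow> [0..<q]]"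

definition sums :: "bool list list \<Rightarrow> bool list list" where
  "sums B = map (\<lambda>(p, q, r). map2 (\<noteq>) (B ! p) (map2 (\<noteq>) (B ! q) (B ! r))) triples @
    map ((!) B) [1..<6]"

text \<open>The exhaustive check of all 512 vectors, done by evaluation.\<close>

lemma full_base: "full 9 (sums (map bits9 base))"
  by (simp add: base_def bits9_def upt_rec bit_Suc_0_iff, code_simp)

lemma distinct_base: "distinct (map bits9 base)"
  by (simp add: base_def bits9_def upt_rec bit_Suc_0_iff)

lemma length_base: "length base = 19"
  by (simp add: base_def)

lemma base_0: "base ! 0 = 0"
  by (simp add: base_def)

lemma base_cases:
  obtains (triple) p q r where "p < q" "q < r" "q < 17" "r < 19"
      "\<And>i. i < 9 \<Longrightarrow> f i \<longleftrightarrow> (bit (base ! p) i \<noteq> (bit (base ! q) i \<noteq> bit (base ! r) i))"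
  | (single) p where "0 < p" "p < 6" "\<And>i. i < 9 \<Longrightarrow> f i \<longleftrightarrow> bit (base ! p) i"
proof -
  define B where "B = map bits9 base"
  have len: "length (B ! p) = 9" if "p < 19" for p
    using that by (simp add: B_def length_base bits9_def)
  have nth: "B ! p ! i = bit (base ! p) i" if "p < 19" "i < 9" for p i
    using that by (simp add: B_def length_base bits9_def)
  have tr: "p < q \<and> q < r \<and> q < 17 \<and> r < 19" if "(p, q, r) \<in> set triples" for p q r
    using that by (auto simp: triples_def)
  have mem_sums: "x \<in> set (sums B) \<longleftrightarrow> (\<exists>p q r. (p, q, r) \<in> set triples \<and>
      x = map2 (\<noteq>) (B ! p) (map2 (\<noteq>) (B ! q) (B ! r))) \<or> (\<exists>p\<in>{1..<6}. x = B ! p)" for x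
    unfolding sums_def set_append set_map set_upt Un_iff image_iff Bex_def split_paired_Ex case_prod_conv
    by (rule refl)
  have "\<forall>x\<in>set (sums B). length x = 9"
  proof
    fix x assume "x \<in> set (sums B)"
    then consider p q r where "(p, q, r) \<in> set triples"
        "x = map2 (\<noteq>) (B ! p) (map2 (\<noteq>) (B ! q) (B ! r))"
      | p where "p \<in> {1..<6}" "x = B ! p"
      unfolding mem_sums by blast
    then show "length x = 9"
      by cases (auto simp: len dest!: tr)
  qed
  then have "map f [0..<9] \<in> set (sums B)"
    using full_base by (intro full_imp_mem[of 9]) (auto simp: B_def)
  then consider p q r where "(p, q, r) \<in> set triples"
      "map f [0..<9] = map2 (\<noteq>) (B ! p) (map2 (\<noteq>) (B ! q) (B ! r))"
    | p where "p \<in> {1..<6}" "map f [0..<9] = B ! p"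
    unfolding mem_sums by blast
  then show ?thesis
  proof cases
    case 1
    from tr[OF 1(1)] have pqr: "p < q" "q < r" "q < 17" "r < 19" by auto
    show ?thesis
    proof (rule triple[OF pqr])
      fix i :: nat assume i: "i < 9"
      then have "f i = map f [0..<9] ! i" by simp
      also have "\<dots> = (B ! p ! i \<noteq> (B ! q ! i \<noteq> B ! r ! i))"
        unfolding 1(2) using i pqr len by simp
      finally show "f i \<longleftrightarrow> (bit (base ! p) i \<noteq> (bit (base ! q) i \<noteq> bit (base ! r) i))"
        using i pqr by (simp add: nth)
    qed
  next
    case 2
    then have p: "0 < p" "p < 6" by auto
    show ?thesis
    proof (rule single[OF p])
      fix i :: nat assume i: "i < 9"
      then have "f i = map f [0..<9] ! i" by simp
      then show "f i \<longleftrightarrow> bit (base ! p) i"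
        unfolding 2(2) using i p by (simp add: nth)
    qed
  qed
qed

section \<open>The parity-check matrix\<close>

text \<open>Column \<open>16 * p + x\<close> of the extended matrix is entry \<open>p\<close> of \<^const>\<open>base\<close> on top of \<open>x\<close>
  times a hyperoval point; the last two entries share their point. The extended column 0 is zero,
  and deleting it gives the parity-check matrix.\<close>

definition ext_col :: "nat \<Rightarrow> nat \<Rightarrow> bool" where
  "ext_col i k =
    (if i < 9 then bit (base ! (k div 16)) i
     else coord (elt (k mod 16) * pnt (min (k div 16) 17) ((i - 9) div 4)) ((i - 9) mod 4))"

definition mat :: "nat \<Rightarrow> nat \<Rightarrow> bool" where
  "mat i j = ext_col i (Suc j)"

text \<open>Coordinate \<open>m\<close> of the GF(16) part of the syndrome, read off four of the
  rows 9 to 20.\<close>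

definition segment :: "nat set \<Rightarrow> nat \<Rightarrow> gf16" where
  "segment v m = gf_of (\<lambda>n. 9 + 4 * m + n \<in> v)"

lemma ext_col_low: "x < 16 \<Longrightarrow> i < 9 \<Longrightarrow> ext_col i (16 * p + x) = bit (base ! p) i"
  by (simp add: ext_col_def)

lemma ext_col_high:
  "x < 16 \<Longrightarrow> n < 4 \<Longrightarrow>
    ext_col (9 + 4 * m + n) (16 * p + x) = coord (elt x * pnt (min p 17) m) n"
  by (simp add: ext_col_def)

lemma ext_col_0 [simp]: "\<not> ext_col i 0"
  by (simp add: ext_col_def base_0)

lemma row_cases:
  assumes "(i :: nat) < 21"
  obtains (low) "i < 9" | (high) m n where "m < 3" "n < 4" "i = 9 + 4 * m + n"
proof (cases "i < 9")
  case False
  then have "(i - 9) div 4 < 3" "(i - 9) mod 4 < 4" "i = 9 + 4 * ((i - 9) div 4) + (i - 9) mod 4"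
    using assms by auto
  then show ?thesis by (rule high)
qed (rule low)

text \<open>Splits the row conditions into nine bits and a linear system over GF(16). The three
  columns may coincide.\<close>

lemma ext_col_sum3:
  assumes "x < 16" "y < 16" "z < 16"
    and "\<And>i. i < 9 \<Longrightarrow> i \<in> v \<longleftrightarrow> (bit (base ! p) i \<noteq> (bit (base ! q) i \<noteq> bit (base ! r) i))"
    and "\<And>m. m < 3 \<Longrightarrow> segment v m =
      elt x * pnt (min p 17) m + elt y * pnt (min q 17) m + elt z * pnt (min r 17) m"
    and "i < 21"
  shows "i \<in> v \<longleftrightarrow>
    (ext_col i (16 * p + x) \<noteq> (ext_col i (16 * q + y) \<noteq> ext_col i (16 * r + z)))"
  using \<open>i < 21\<close>
proof (cases rule: row_cases)
  case low
  then show ?thesis using assms by (simp add: ext_col_low)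
next
  case (high m n)
  then have "i \<in> v \<longleftrightarrow> coord (segment v m) n" by (simp add: segment_def)
  with high show ?thesis using assms by (auto simp: ext_col_high coord_add)
qed

text \<open>The first nine rows determine the block, and a nonzero coordinate of its point
  determines the scalar. Since column 0 is included, no other column is zero.\<close>

lemma ext_col_inj:
  assumes "k < 304" "l < 304" "\<And>i. i < 21 \<Longrightarrow> ext_col i k = ext_col i l"
  shows "k = l"
proof -
  define p x q y where "p = k div 16" and "x = k mod 16" and "q = l div 16" and "y = l mod 16"
  have kl: "k = 16 * p + x" "l = 16 * q + y" and xy: "x < 16" "y < 16" and pq: "p < 19" "q < 19"
    using assms(1,2) by (auto simp: p_def x_def q_def y_def)
  have "bit (base ! p) i = bit (base ! q) i" if "i < 9" for i
    using assms(3)[of i] that xy unfolding kl by (simp add: ext_col_low)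
  then have "bits9 (base ! p) = bits9 (base ! q)" by (simp add: bits9_def)
  with distinct_base pq have "p = q"
    using nth_eq_iff_index_eq[of "map bits9 base" p q] by (simp add: length_base)
  let ?t = "min p 17"
  obtain m where m: "m < 3" "pnt ?t m \<noteq> 0"
  proof -
    have "pnt ?t 0 \<noteq> 0 \<or> pnt ?t 1 \<noteq> 0 \<or> pnt ?t 2 \<noteq> 0"
      by (auto simp: pnt_def)
    then show ?thesis using that[of 0] that[of 1] that[of 2] by auto
  qed
  have "elt x * pnt ?t m = elt y * pnt ?t m"
  proof (rule gf16_eqI)
    fix n :: nat assume "n < 4"
    then show "coord (elt x * pnt ?t m) n = coord (elt y * pnt ?t m) n"
      using assms(3)[of "9 + 4 * m + n"] m xy \<open>p = q\<close> unfolding kl by (simp add: ext_col_high)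
  qed
  with m have "elt x = elt y" by simp
  with xy \<open>p = q\<close> show ?thesis unfolding kl using elt_inj by simp
qed

text \<open>The index shift drops 0 from \<open>K\<close>, which is harmless because that extended
  column is zero.\<close>

lemma colsum_mat:
  assumes "finite K"
  shows "colsum mat r {j. Suc j \<in> K} = {i. i < r \<and> odd (card {k \<in> K. ext_col i k})}"
proof -
  have "{k \<in> K. ext_col i k} = Suc ` {j \<in> {j. Suc j \<in> K}. mat i j}" for i
    by (auto simp: mat_def image_iff) (metis ext_col_0 not0_implies_Suc)
  then show ?thesis by (simp add: colsum_def card_image)
qed

text \<open>The sum can be evaluated by simplification over an explicit set.\<close>

lemma odd_card_Collect:
  assumes "finite K"
  shows "odd (card {k \<in> K. P k}) \<longleftrightarrow> odd (\<Sum>k\<in>K. of_bool (P k) :: nat)"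
  using assms by (simp add: Int_def)

lemma colsum_mat_3:
  assumes "card {k, l, m} = 3" "v \<subseteq> {..<21}"
    "\<And>i. i < 21 \<Longrightarrow> i \<in> v \<longleftrightarrow> (ext_col i k \<noteq> (ext_col i l \<noteq> ext_col i m))"
  shows "colsum mat 21 {j. Suc j \<in> {k, l, m}} = v"
proof -
  have "k \<noteq> l" "k \<noteq> m" "l \<noteq> m"
    using assms(1) by (auto simp: card_insert_if split: if_splits)
  then have "odd (card {j \<in> {k, l, m}. ext_col i j}) \<longleftrightarrow> (ext_col i k \<noteq> (ext_col i l \<noteq> ext_col i m))" for i
    by (subst odd_card_Collect) (auto simp del: sum_of_bool_eq)
  then have "colsum mat 21 {j. Suc j \<in> {k, l, m}} =
      {i. i < 21 \<and> (ext_col i k \<noteq> (ext_col i l \<noteq> ext_col i m))}"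
    by (subst colsum_mat) auto
  also have "\<dots> = v" using assms(2,3) by auto
  finally show ?thesis .
qed

lemma colsum_mat_1:
  assumes "v \<subseteq> {..<21}" "\<And>i. i < 21 \<Longrightarrow> i \<in> v \<longleftrightarrow> ext_col i k"
  shows "colsum mat 21 {j. Suc j \<in> {k}} = v"
proof -
  have "odd (card {j \<in> {k}. ext_col i j}) \<longleftrightarrow> ext_col i k" for i
    by (subst odd_card_Collect) (auto simp del: sum_of_bool_eq)
  then have "colsum mat 21 {j. Suc j \<in> {k}} = {i. i < 21 \<and> ext_col i k}"
    by (subst colsum_mat) auto
  also have "\<dots> = v" using assms by auto
  finally show ?thesis .
qed

text \<open>Splitting the columns over one hyperoval point into \<open>x = 0\<close> and \<open>x \<noteq> 0\<close> allows the use of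
  two columns of the same block, one of them with \<open>x = 0\<close>. Label 0 is taken only by the
  deleted column 0, which leaves 35 labels.\<close>

definition label :: "nat \<Rightarrow> nat" where
  "label k = 2 * min (k div 16) 17 + of_bool (k mod 16 \<noteq> 0)"

lemma label_simp: "x < 16 \<Longrightarrow> label (16 * p + x) = 2 * min p 17 + of_bool (x \<noteq> 0)"
  by (simp add: label_def)

lemma label_neq:
  "x < 16 \<Longrightarrow> y < 16 \<Longrightarrow> min p 17 \<noteq> min q 17 \<Longrightarrow> label (16 * p + x) \<noteq> label (16 * q + y)"
  by (simp add: label_simp)

lemma inj_on_3:
  assumes "f k \<noteq> f l" "f k \<noteq> f m" "f l \<noteq> f m"
  shows "inj_on f {k, l, m}" "card {k, l, m} = 3"
proof -
  have "k \<noteq> l" "k \<noteq> m" "l \<noteq> m" using assms by auto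
  with assms show "inj_on f {k, l, m}" "card {k, l, m} = 3" by auto
qed

text \<open>The degenerate case supplies two representations: one column for the (3,1)-partition,
  three columns of one block for the (3,2)-partition.\<close>

lemma column_representation:
  assumes "v \<subseteq> {..<21}"
  obtains (spread) K where "K \<subseteq> {..<304}" "card K = 3" "colsum mat 21 {j. Suc j \<in> K} = v" "inj_on label K"
  | (single) k K where "0 < k" "k < 304" "colsum mat 21 {j. Suc j \<in> {k}} = v"
      "K \<subseteq> {..<304}" "card K = 3" "colsum mat 21 {j. Suc j \<in> K} = v"
proof (rule base_cases[of "\<lambda>i. i \<in> v"])
  fix p q r assume pqr: "p < q" "q < r" "q < 17" "r < 19"
    and low: "\<And>i. i < 9 \<Longrightarrow> i \<in> v \<longleftrightarrow> (bit (base ! p) i \<noteq> (bit (base ! q) i \<noteq> bit (base ! r) i))"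
  have mins: "min p 17 < min q 17" "min q 17 < min r 17" "min r 17 < 18" using pqr by auto
  obtain a b c where abc: "\<forall>m<3. segment v m =
      a * pnt (min p 17) m + b * pnt (min q 17) m + c * pnt (min r 17) m"
    using pnt_independent[OF mins, of "segment v"] by blast
  obtain x y z where xyz: "x < 16" "elt x = a" "y < 16" "elt y = b" "z < 16" "elt z = c"
    using elt_surj by metis
  have "i \<in> v \<longleftrightarrow>
      (ext_col i (16 * p + x) \<noteq> (ext_col i (16 * q + y) \<noteq> ext_col i (16 * r + z)))"
    if "i < 21" for i
    by (rule ext_col_sum3) (use that low xyz abc in simp_all)
  moreover have "inj_on label {16 * p + x, 16 * q + y, 16 * r + z}"
      "card {16 * p + x, 16 * q + y, 16 * r + z} = 3"
    using pqr xyz by (intro inj_on_3[of label] label_neq; simp)+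
  ultimately show thesis
    using pqr xyz assms
    by (intro spread[of "{16 * p + x, 16 * q + y, 16 * r + z}"] colsum_mat_3) simp_all
next
  fix p assume p: "0 < p" "p < 6"
    and low: "\<And>i. i < 9 \<Longrightarrow> i \<in> v \<longleftrightarrow> bit (base ! p) i"
  obtain t a b where t: "t < 18" "t \<noteq> p" and ab: "\<forall>m<3. segment v m = a * pnt p m + b * pnt t m"
    using pnt_secants_cover[of p "segment v"] p by auto
  obtain x y where xy: "x < 16" "elt x = a" "y < 16" "elt y = b"
    using elt_surj by metis
  show thesis
  proof (cases "y = 0")
    case False
    \<comment> \<open>The two columns of block \<open>t\<close> cancel in the first nine rows and
      leave \<open>elt y\<close> times the point; \<open>y\<close> being nonzero separates their
      labels.\<close>
    have "i \<in> v \<longleftrightarrow>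
        (ext_col i (16 * p + x) \<noteq> (ext_col i (16 * t + y) \<noteq> ext_col i (16 * t + 0)))"
      if "i < 21" for i
      using that low ab xy p t by (intro ext_col_sum3) auto
    moreover have "inj_on label {16 * p + x, 16 * t + y, 16 * t + 0}"
        "card {16 * p + x, 16 * t + y, 16 * t + 0} = 3"
      using label_neq[of x y p t] label_neq[of x 0 p t] label_simp[of y t] label_simp[of 0 t] p t xy False
      by (intro inj_on_3[of label]; simp)+
    ultimately show thesis
      using p t xy assms
      by (intro spread[of "{16 * p + x, 16 * t + y, 16 * t + 0}"] colsum_mat_3) simp_all
  next
    case True
    with xy have ab': "segment v m = elt x * pnt p m" if "m < 3" for m
      using ab that by simp
    \<comment> \<open>The zero column, added twice, reduces the three-column lemma to one
      column.\<close>
    have "i \<in> v \<longleftrightarrow> (ext_col i (16 * p + x) \<noteq> (ext_col i (16 * 0 + 0) \<noteq> ext_col i (16 * 0 + 0)))"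
      if "i < 21" for i
      using that low ab' xy p by (intro ext_col_sum3) auto
    then have 1: "colsum mat 21 {j. Suc j \<in> {16 * p + x}} = v"
      using assms by (intro colsum_mat_1) auto
    \<comment> \<open>Shifting \<open>a\<close> by three distinct elements of sum zero gives
      distinct scalars of sum 3a = a.\<close>
    obtain x1 x2 x3 where x': "x1 < 16" "elt x1 = a + elt 1" "x2 < 16" "elt x2 = a + elt 2"
        "x3 < 16" "elt x3 = a + elt 3"
      using elt_surj by metis
    have "elt 3 = elt 1 + elt 2" by (simp add: elt_def gf_of_def bit_Suc_0_iff)
    then have "elt x1 + elt x2 + elt x3 = a + (a + a) + ((elt 1 + elt 2) + (elt 1 + elt 2))"
      unfolding x' by (simp only: add_ac)
    then have sum: "elt x1 + elt x2 + elt x3 = a"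
      by (simp only: gf16_double add_0_right)
    have "x1 \<noteq> x2" "x1 \<noteq> x3" "x2 \<noteq> x3"
      using x' elt_inj[of 1 2] elt_inj[of 1 3] elt_inj[of 2 3] by auto
    then have "card {16 * p + x1, 16 * p + x2, 16 * p + x3} = 3" by simp
    moreover have "i \<in> v \<longleftrightarrow>
        (ext_col i (16 * p + x1) \<noteq> (ext_col i (16 * p + x2) \<noteq> ext_col i (16 * p + x3)))"
      if "i < 21" for i
      using that low ab' xy p x' sum
      by (intro ext_col_sum3) (auto simp flip: distrib_right)
    ultimately show thesis
      using p xy x' assms 1
      by (intro single[of "16 * p + x" "{16 * p + x1, 16 * p + x2, 16 * p + x3}"] colsum_mat_3) simp_all
  qed
qed

section \<open>Partitions, covering radius and minimum distance\<close>

lemma card_shift: "card {j. Suc j \<in> K} = card (K - {0})"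
proof -
  have "K - {0} = Suc ` {j. Suc j \<in> K}"
    by (auto simp: image_iff) (metis not0_implies_Suc)
  then show ?thesis by (simp add: card_image)
qed

lemma shift_subset: "K \<subseteq> {..<304} \<Longrightarrow> {j. Suc j \<in> K} \<subseteq> {..<303}"
  by auto

text \<open>Deleting column 0 may cost one of the three columns, hence the lower bound 2.\<close>

lemma card_shift_3:
  assumes "card K = 3"
  shows "2 \<le> card {j. Suc j \<in> K}" "card {j. Suc j \<in> K} \<le> 3"
  using assms by (auto simp: card_shift card_Diff_singleton_if)

lemma mat_partition_2: "\<exists>P. is_RL_partition mat 21 303 3 2 P"
\<comment> \<open>Labelling by \<open>id\<close> gives singletons, so only the number of columns
  matters.\<close>
proof (rule exI, rule is_RL_partition_fibres[where f = id])
  fix v :: "nat set" assume "v \<subseteq> {..<21}"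
  then obtain K where "K \<subseteq> {..<304}" "card K = 3" "colsum mat 21 {j. Suc j \<in> K} = v"
    using column_representation by metis
  then show "\<exists>S\<subseteq>{..<303}. 2 \<le> card S \<and> card S \<le> 3 \<and> colsum mat 21 S = v \<and> inj_on id S"
    using card_shift_3 shift_subset by (intro exI[of _ "{j. Suc j \<in> K}"]) auto
qed

lemma mat_partition_1: "\<exists>P. is_RL_partition mat 21 303 3 1 P \<and> card P \<le> 35"
proof (intro exI conjI)
  let ?f = "\<lambda>j. label (Suc j)"
  show "is_RL_partition mat 21 303 3 1 ((\<lambda>c. {j. j < 303 \<and> ?f j = c}) ` ?f ` {..<303})"
  proof (rule is_RL_partition_fibres)
    fix v :: "nat set" assume "v \<subseteq> {..<21}"
    then show "\<exists>S\<subseteq>{..<303}. 1 \<le> card S \<and> card S \<le> 3 \<and> colsum mat 21 S = v \<and> inj_on ?f S"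
    proof (cases rule: column_representation)
      case (spread K)
      then have "inj_on ?f {j. Suc j \<in> K}"
        by (auto simp: inj_on_def)
      with spread show ?thesis
        using card_shift_3[of K] shift_subset by (intro exI[of _ "{j. Suc j \<in> K}"]) auto
    next
      case (single k K)
      then obtain j where "k = Suc j" using not0_implies_Suc by blast
      with single show ?thesis by (intro exI[of _ "{j}"]) auto
    qed
  qed
  have "label (Suc j) \<in> {1..35}" for j
  proof -
    have "label k \<noteq> 0" if "k > 0" for k
      using that div_mult_mod_eq[of k 16] by (auto simp: label_def min_def)
    then show ?thesis by (auto simp: label_def Suc_le_eq)
  qed
  then have "?f ` {..<303} \<subseteq> {1..35}" by blast
  then have "card (?f ` {..<303}) \<le> card {1..35 :: nat}"
    by (intro card_mono) auto
  then show "card ((\<lambda>c. {j. j < 303 \<and> ?f j = c}) ` ?f ` {..<303}) \<le> 35"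
    using card_image_le[of "?f ` {..<303}" "\<lambda>c. {j. j < 303 \<and> ?f j = c}"] by simp
qed

lemma mat_covering_radius: "has_covering_radius mat 21 303 3"
proof -
  have "covers mat 21 303 3"
    using mat_partition_1 unfolding is_RL_partition_def covers_def by blast
  moreover have "\<not> covers mat 21 303 R" if "R < 3" for R
  proof
    assume "covers mat 21 303 R"
    moreover have "R \<le> 2" using that by simp
    ultimately have "covers mat 21 303 2"
      using \<open>R \<le> 2\<close> unfolding covers_def by (meson le_trans)
    \<comment> \<open>Here 303^2 + 1 = 91810 is less than 2^21.\<close>
    then show False using not_covers_2[of 303 21] by simp
  qed
  ultimately show ?thesis by (simp add: has_covering_radius_def)
qed

lemma mat_min_distance: "has_min_distance mat 21 303 3"
  unfolding has_min_distance_def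
proof (intro conjI ballI impI)
  \<comment> \<open>Block 0 has first part zero, so its columns with scalars of sum zero form a
    codeword of weight 3.\<close>
  have "elt 1 + elt 2 + elt 3 = 0" by (simp add: elt_def gf_of_def zero_gf16_def bit_Suc_0_iff)
  then have *: "i \<in> {} \<longleftrightarrow> (ext_col i 1 \<noteq> (ext_col i 2 \<noteq> ext_col i 3))" if "i < 21" for i
    using that ext_col_sum3[of 1 2 3 "{}" 0 0 0 i]
    by (simp add: base_0 segment_def gf_of_def numeral_2_eq_2 flip: distrib_right zero_gf16_def)
  have "colsum mat 21 {j. Suc j \<in> {1, 2, 3}} = {}"
    by (rule colsum_mat_3[OF _ _ *]) simp_all
  moreover have "{j. Suc j \<in> {1, 2, 3}} = {0, 1, 2}" by auto
  ultimately have "{0, 1, 2} \<in> code mat 21 303" by (simp add: code_def)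
  then show "\<exists>S\<in>code mat 21 303. S \<noteq> {} \<and> card S = 3"
    by (intro bexI[of _ "{0, 1, 2}"]) auto
next
  fix S assume S: "S \<in> code mat 21 303" "S \<noteq> {}"
  then have fin: "finite S" and sub: "S \<subseteq> {..<303}" and cs: "colsum mat 21 S = {}"
    by (auto simp: code_def intro: finite_subset)
  have even: "\<not> odd (card {j \<in> S. mat i j})" if "i < 21" for i
    using cs that by (auto simp: colsum_def)
  show "3 \<le> card S"
  proof (rule ccontr)
    assume "\<not> 3 \<le> card S"
    with S(2) fin have "card S = 1 \<or> card S = 2"
      using card_gt_0_iff[of S] by linarith
    then consider a where "S = {a}" | a b where "S = {a, b}" "a \<noteq> b"
      by (auto simp: card_1_singleton_iff card_2_iff)
    then show False
    proof cases
      case 1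
      \<comment> \<open>A codeword of weight 1 would be a zero column, that is, a repetition of
        extended column 0.\<close>
      then have "ext_col i (Suc a) = ext_col i 0" if "i < 21" for i
        using even[OF that, unfolded odd_card_Collect[OF fin]] by (simp add: mat_def del: sum_of_bool_eq)
      with 1 sub show False using ext_col_inj[of "Suc a" 0] by auto
    next
      case 2
      then have "ext_col i (Suc a) = ext_col i (Suc b)" if "i < 21" for i
        using even[OF that, unfolded odd_card_Collect[OF fin]]
          by (auto simp: mat_def simp del: sum_of_bool_eq)
      with 2 sub show False using ext_col_inj[of "Suc a" "Suc b"] by auto
    qed
  qed
qed

theorem theorem7p2:
  shows "(\<exists>H :: nat \<Rightarrow> nat \<Rightarrow> bool.
            has_codimension H 21 303 \<and> has_min_distance H 21 303 3 \<and>
            has_covering_radius H 21 303 3 \<and>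
            (\<exists>P. is_RL_partition H 21 303 3 2 P) \<and>
            (\<exists>P. is_RL_partition H 21 303 3 1 P \<and> card P \<le> 35))
         \<and> ell2 21 3 \<le> 303"
proof
  have codim: "has_codimension mat 21 303"
    using mat_covering_radius has_codimension_if_covers[of mat 21 303 3]
    by (simp add: has_covering_radius_def)
  show "\<exists>H :: nat \<Rightarrow> nat \<Rightarrow> bool.
            has_codimension H 21 303 \<and> has_min_distance H 21 303 3 \<and>
            has_covering_radius H 21 303 3 \<and>
            (\<exists>P. is_RL_partition H 21 303 3 2 P) \<and>
            (\<exists>P. is_RL_partition H 21 303 3 1 P \<and> card P \<le> 35)"
    using codim mat_min_distance mat_covering_radius mat_partition_2 mat_partition_1 by blast
  show "ell2 21 3 \<le> 303"
    unfolding ell2_def using codim mat_covering_radius by (intro Least_le) blast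
qed

end
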